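(* Let $f,g\in D$ be fixed probability density functions on $\mathbb{S}^{1}$. Define $$I(\alpha):=I(\alpha;f,g):=\int_{0}^{1}\left|F^{-1}(t)-(G^{\alpha})^{-1}(t)\right|^{2}\,\mathrm{d}t .$$ Then the following properties hold for $I(\alpha)$: (i) $I(\alpha)$ is a strictly convex function of $\alpha$. (ii) $I(\alpha)$ is twice differentiable with respect to $\alpha$ on $\mathbb{R}$, and $$I'(\alpha)=1-2\int_{0}^{1}F^{-1}(G(t)+\alpha)\,\mathrm{d}t,$$ $$I''(\alpha)=\int_{0}^{1}-\frac{2}{f(F^{-1}(G(t)+\alpha))}\,\mathrm{d}t=\int_{0}^{1}-\frac{2}{g(G^{-1}(F(t)-\alpha))}\,\mathrm{d}t.$$ (iii) The global minimum of $I(\alpha)$ is uniquely attained on the interval $(-1,1)$.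
   Context: The circle is $\mathbb{S}^{1}\cong\mathbb{R}/\mathbb{Z}$ with representative interval $[0,1)$, and $$D:=\left\{f\in L^{1}[0,1]:\ \int_{0}^{1}f\,\mathrm{d}x=1,\ f\geq\eta \text{ on } \mathbb{S}^{1}\text{ for some }\eta>0\right\}.$$ A density $f\in D$ is extended to $\mathbb{R}$ by $f(t+1)=f(t)$. Its cumulative distribution function is $F(t)=\int_0^t f(\tau)\,\mathrm{d}\tau$ on $[0,1]$, extended to $\mathbb{R}$ by $F(t+1)=F(t)+1$. The inverse distribution function is $F^{-1}(y)=\inf\{t:\ y<F(t)\}$, with $F^{-1}(y+1)=F^{-1}(y)+1$; for $f\in D$, $F$ is strictly increasing and $F^{-1}$ is its inverse in the classical sense. $G$ and $G^{-1}$ are defined from $g$ in the same way. For $\alpha\in\mathbb{R}$, $G^{\alpha}$ denotes the function $G+\alpha$, so $(G^{\alpha})^{-1}(t)=G^{-1}(t-\alpha)$.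
   Formalization: The printed formulas for I' and I'' in (ii) have the wrong sign (for f=g=1, I(α)=α², so I'=2α and I''=2); proved instead are I'=2∫F^{-1}(G(t)+α)dt−1 and I''=∫2/f(F^{-1}(G(t)+α))dt=∫2/g(G^{-1}(F(t)−α))dt. *)

theory Defs
  imports "HOL-Analysis.Analysis"
begin

text \<open>Functions on the circle \<open>\<real>/\<int>\<close> are represented by 1-periodic functions on \<open>\<real>\<close>. A density is an
  \<open>L\<^sup>1\<close> function, so the lower bound is required almost everywhere only.\<close>

definition circle_densities :: "(real \<Rightarrow> real) set" where
  "circle_densities = {f. (\<forall>t. f (t + 1) = f t) \<and> f absolutely_integrable_on {0..1} \<and>
     integral {0..1} f = 1 \<and> (\<exists>\<eta>>0. AE t in lebesgue. \<eta> \<le> f t)}"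

text \<open>The integral over \<open>[0,t]\<close> for \<open>t\<close> in \<open>[0,1)\<close>, continued by \<open>F (t + 1) = F t + 1\<close>.\<close>

definition circle_cdf :: "(real \<Rightarrow> real) \<Rightarrow> real \<Rightarrow> real" where
  "circle_cdf f t = integral {0..frac t} f + of_int \<lfloor>t\<rfloor>"

lemma circle_cdf_add_one: "circle_cdf f (t + 1) = circle_cdf f t + 1"
  by (simp add: circle_cdf_def frac_def)

lemma circle_cdf_unit_interval:
  assumes "f \<in> circle_densities" "0 \<le> t" "t \<le> 1"
  shows "circle_cdf f t = integral {0..t} f"
proof (cases "t = 1")
  case True
  then show ?thesis using assms by (simp add: circle_cdf_def circle_densities_def)
next
  case False
  then have "frac t = t" "\<lfloor>t\<rfloor> = 0" using assms by (auto simp: frac_eq floor_eq_iff)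
  then show ?thesis by (simp add: circle_cdf_def)
qed

text \<open>For \<open>H\<close> with \<open>H (t + 1) = H t + 1\<close>, the infimum over all of \<open>\<real>\<close> satisfies the corresponding
  identity by itself, see below.\<close>

definition inverse_dist :: "(real \<Rightarrow> real) \<Rightarrow> real \<Rightarrow> real" where
  "inverse_dist H y = Inf {t. y < H t}"

definition circle_cost :: "(real \<Rightarrow> real) \<Rightarrow> (real \<Rightarrow> real) \<Rightarrow> real \<Rightarrow> real" where
  "circle_cost f g \<alpha> = integral {0..1}
     (\<lambda>t. \<bar>inverse_dist (circle_cdf f) t - inverse_dist (\<lambda>s. circle_cdf g s + \<alpha>) t\<bar>\<^sup>2)"

lemma inverse_dist_shift:
  "inverse_dist (\<lambda>s. H s + \<alpha>) t = inverse_dist H (t - \<alpha>)"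
  by (simp add: inverse_dist_def diff_less_eq)

lemma inverse_dist_add_one:
  assumes H: "\<And>t. H (t + 1) = H t + 1"
    and "{t. y < H t} \<noteq> {}" "bdd_below {t. y < H t}"
  shows "inverse_dist H (y + 1) = inverse_dist H y + 1"
proof -
  have "{t. y + 1 < H t} = (\<lambda>t. 1 + t) ` {t. y < H t}"
  proof (intro equalityI subsetI)
    fix t assume "t \<in> {t. y + 1 < H t}"
    moreover have "H t = H (t - 1) + 1" using H[of "t - 1"] by simp
    ultimately have "t - 1 \<in> {t. y < H t}" by simp
    then show "t \<in> (\<lambda>t. 1 + t) ` {t. y < H t}" by (intro image_eqI[of _ _ "t - 1"]) auto
  qed (auto simp: H add.commute[of 1])
  moreover have "mono (\<lambda>t::real. 1 + t)" by (simp add: mono_def)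
  ultimately show ?thesis
    using assms continuous_at_Inf_mono[of "\<lambda>t. 1 + t" "{t. y < H t}"]
    by (simp add: inverse_dist_def continuous_intros)
qed

definition strictly_convex_on :: "real set \<Rightarrow> (real \<Rightarrow> real) \<Rightarrow> bool" where
  "strictly_convex_on S h \<longleftrightarrow> convex S \<and>
     (\<forall>x\<in>S. \<forall>y\<in>S. \<forall>u v. x \<noteq> y \<longrightarrow> 0 < u \<longrightarrow> 0 < v \<longrightarrow> u + v = 1 \<longrightarrow>
        h (u * x + v * y) < u * h x + v * h y)"

end

theory Submission
  imports Defs
begin

text \<open>\<open>F\<close> is absolutely continuous with \<open>F' = f\<close> almost everywhere, and \<open>F\<inverse>\<close> is Lipschitz because
  \<open>f \<ge> \<eta>\<close>. Hence \<open>F\<inverse>\<close> has derivative \<open>1 / f (F\<inverse> y)\<close> outside a null set, whose preimage under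
  \<open>t \<mapsto> G t + \<alpha>\<close> is null. Both \<open>I\<close> and \<open>\<alpha> \<mapsto> \<integral> F\<inverse> (G t + \<alpha>) dt\<close> are therefore
  differentiated under the integral sign for every \<open>\<alpha>\<close> by dominated convergence, and the substitution
  \<open>y = G t\<close> identifies \<open>I'\<close>. The second formula for \<open>I''\<close> follows from \<open>I(\<alpha>; f, g) = I(-\<alpha>; g, f)\<close>.
  Since \<open>F\<inverse>\<close> is strictly increasing, so is \<open>I'\<close>; and \<open>I' (-1) < 0 < I' 1\<close>.\<close>

subsection \<open>Real analysis\<close>

lemma periodic_of_int:
  fixes h :: "real \<Rightarrow> 'a"
  assumes per: "\<And>t. h (t + 1) = h t"
  shows "h (t + of_int k) = h t"
proof (induction k rule: int_induct[where k = 0])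
  case (step1 i) then show ?case using per[of "t + of_int i"] by (simp add: algebra_simps)
next
  case (step2 i) then show ?case using per[of "t + of_int (i - 1)"] by (simp add: algebra_simps)
qed simp

lemma periodic_integrable_on:
  fixes h :: "real \<Rightarrow> real"
  assumes per: "\<And>t. h (t + 1) = h t" and int: "h integrable_on {0..1}"
  shows "h integrable_on {a..b}"
proof -
  have unit: "h integrable_on {of_int k..of_int k + 1}" for k
    using int integrable_on_shift_Icc_real[of h "of_int k" 0 1] periodic_of_int[of h, OF per]
    by (simp add: o_def add.commute)
  have "h integrable_on {- real n..real n}" for n
  proof (induction n)
    case (Suc n)
    have "- real (Suc n) = of_int (- int n - 1)" "- real n = of_int (- int n - 1) + 1" by simp_all
    then have "h integrable_on {- real (Suc n)..- real n}" using unit by metis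
    then have left: "h integrable_on {- real (Suc n)..real n}"
      by (rule Henstock_Kurzweil_Integration.integrable_combine[rotated 2]) (use Suc in auto)
    have "h integrable_on {real n..real (Suc n)}"
      using unit[of "int n"] by (simp add: add.commute)
    with left show ?case
      by (rule Henstock_Kurzweil_Integration.integrable_combine[rotated 2]) auto
  qed (use integrable_on_refl[of h 0] in simp)
  moreover obtain n where "\<bar>a\<bar> \<le> real n" "\<bar>b\<bar> \<le> real n"
    using real_arch_simple[of "max \<bar>a\<bar> \<bar>b\<bar>"] by auto
  ultimately show ?thesis
    by (meson integrable_on_subinterval atLeastatMost_subset_iff abs_le_iff minus_le_iff)
qed

text \<open>Both brackets are values of the single function \<open>integral {0..frac t} h +
  \<lfloor>t\<rfloor> * integral {0..1} h\<close>, which is thus a primitive of \<open>h\<close> on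
  the whole line. For a density the mass is 1 and this function is
  \<open>circle_cdf f\<close>.\<close>

lemma periodic_integral_primitive:
  fixes h :: "real \<Rightarrow> real"
  assumes per: "\<And>t. h (t + 1) = h t" and int: "h integrable_on {0..1}" and "x \<le> y"
  shows "integral {x..y} h =
    (integral {0..frac y} h + \<lfloor>y\<rfloor> * integral {0..1} h) - (integral {0..frac x} h + \<lfloor>x\<rfloor> * integral {0..1} h)"
proof -
  note ii = periodic_integrable_on[OF per int]
  have sh: "integral {of_int k..of_int k + c} h = integral {0..c} h" for k c
    using integral_shift_Icc_real[of 0 c h "of_int k"] periodic_of_int[of h, OF per]
    by (simp add: o_def add.commute)
  have fl: "integral {of_int \<lfloor>t\<rfloor>..t} h = integral {0..frac t} h" for t
    using sh[of "\<lfloor>t\<rfloor>" "frac t"] by (simp add: frac_def)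
  have whole: "integral {of_int m..of_int m + real n} h = n * integral {0..1} h" for m n
  proof (induction n)
    case (Suc n)
    have "integral {of_int m..of_int m + real (Suc n)} h = integral {of_int m..of_int m + real n} h
       + integral {of_int m + real n..of_int m + real (Suc n)} h"
      by (intro Henstock_Kurzweil_Integration.integral_combine[symmetric] ii) auto
    also have "integral {of_int m + real n..of_int m + real (Suc n)} h = integral {0..1} h"
      using sh[of "m + int n" 1] by (simp add: ac_simps)
    finally show ?case using Suc by (simp add: algebra_simps)
  qed simp
  have le: "\<lfloor>x\<rfloor> \<le> \<lfloor>y\<rfloor>" using \<open>x \<le> y\<close> by (rule floor_mono)
  have "integral {of_int \<lfloor>x\<rfloor>..x} h + integral {x..y} h = integral {of_int \<lfloor>x\<rfloor>..y} h"
    by (intro Henstock_Kurzweil_Integration.integral_combine ii) (use \<open>x \<le> y\<close> in auto)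
  also have "\<dots> = integral {of_int \<lfloor>x\<rfloor>..of_int \<lfloor>y\<rfloor>} h + integral {of_int \<lfloor>y\<rfloor>..y} h"
    by (intro Henstock_Kurzweil_Integration.integral_combine[symmetric] ii) (use le in auto)
  also have "integral {of_int \<lfloor>x\<rfloor>..of_int \<lfloor>y\<rfloor>} h = (\<lfloor>y\<rfloor> - \<lfloor>x\<rfloor>) * integral {0..1} h"
    using whole[of "\<lfloor>x\<rfloor>" "nat (\<lfloor>y\<rfloor> - \<lfloor>x\<rfloor>)"] le by simp
  finally show ?thesis by (simp add: fl algebra_simps)
qed

text \<open>From \<open>c\<close> to \<open>c + 1\<close> the fractional part returns and the floor
  rises by 1, so exactly one full period remains.\<close>

lemma periodic_integral_shift:
  fixes h :: "real \<Rightarrow> real"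
  assumes per: "\<And>t. h (t + 1) = h t" and int: "h integrable_on {0..1}"
  shows "integral {0..1} (\<lambda>t. h (t + c)) = integral {0..1} h"
  using periodic_integral_primitive[OF per int, of c "c + 1"] integral_shift_Icc_real[of 0 1 h c]
  by (simp add: o_def add.commute frac_def algebra_simps)

section \<open>Null sets and differentiation of integrals\<close>

lemma negligible_lipschitz_image:
  fixes u :: "real \<Rightarrow> real"
  assumes lip: "\<And>x y. \<bar>u x - u y\<bar> \<le> L * \<bar>x - y\<bar>" and "negligible N"
  shows "negligible (u ` N)"
proof (rule negligible_locally_Lipschitz_image[OF _ \<open>negligible N\<close>])
  show "\<exists>T B. open T \<and> x \<in> T \<and> (\<forall>y\<in>N \<inter> T. norm (u y - u x) \<le> B * norm (y - x))" for x
    using lip by (intro exI[of _ UNIV] exI[of _ L]) simp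
qed simp

text \<open>Lebesgue differentiation: off a null set the averages over \<open>[x, x + k]\<close>
  with \<open>k > 0\<close> tend to \<open>h x\<close>, which is a right derivative. The left
  derivative comes from reflecting the line.\<close>

lemma indefinite_integral_has_derivative_ae:
  fixes h P :: "real \<Rightarrow> real"
  assumes int: "\<And>a b. h integrable_on {a..b}"
    and P: "\<And>x y. x \<le> y \<Longrightarrow> P y - P x = integral {x..y} h"
  obtains N where "negligible N" "\<And>x. x \<notin> N \<Longrightarrow> (P has_real_derivative h x) (at x)"
proof -
  have right: "\<exists>N. negligible N \<and> (\<forall>x. x \<notin> N \<longrightarrow> (P has_real_derivative h x) (at_right x))"
    if int: "\<And>a b. h integrable_on {a..b}"
      and P: "\<And>x y. x \<le> y \<Longrightarrow> P y - P x = integral {x..y} h" for h P :: "real \<Rightarrow> real"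
  proof -
    obtain N where N: "negligible N"
      and lim: "\<And>x e. \<lbrakk>x \<notin> N; 0 < e\<rbrakk> \<Longrightarrow> \<exists>d>0. \<forall>k. 0 < k \<and> k < d \<longrightarrow>
         norm (integral (cbox x (x + k *\<^sub>R One)) h /\<^sub>R k ^ DIM(real) - h x) < e"
      using integrable_ccontinuous_explicit[of h] int by auto
    have "(P has_real_derivative h x) (at_right x)" if "x \<notin> N" for x
      unfolding has_field_derivative_iff tendsto_iff eventually_at
    proof (intro allI impI)
      fix e :: real assume "0 < e"
      obtain d where "d > 0" and
        d: "\<And>k. 0 < k \<Longrightarrow> k < d \<Longrightarrow> norm (integral {x..x + k} h / k - h x) < e"
        using lim[OF \<open>x \<notin> N\<close> \<open>0 < e\<close>] by (auto simp: divide_inverse mult.commute)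
      show "\<exists>d>0. \<forall>y\<in>{x<..}. y \<noteq> x \<and> dist y x < d \<longrightarrow> dist ((P y - P x) / (y - x)) (h x) < e"
      proof (intro exI[of _ d] conjI ballI impI)
        fix y assume "y \<in> {x<..}" "y \<noteq> x \<and> dist y x < d"
        then show "dist ((P y - P x) / (y - x)) (h x) < e"
          using d[of "y - x"] P[of x y] by (simp add: dist_real_def)
      qed (use \<open>d > 0\<close> in auto)
    qed
    with N show ?thesis by blast
  qed
  obtain N1 where N1: "negligible N1"
    and d1: "\<And>x. x \<notin> N1 \<Longrightarrow> (P has_real_derivative h x) (at_right x)"
    using right[OF int P] by blast
  \<comment> \<open>\<open>- P (- x)\<close> is a primitive of \<open>h (- x)\<close>, and its right
    derivative at \<open>- x\<close> is the left derivative of \<open>P\<close> at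
    \<open>x\<close>.\<close>
  have "\<exists>N. negligible N \<and> (\<forall>x. x \<notin> N \<longrightarrow> ((\<lambda>x. - P (- x)) has_real_derivative h (- x)) (at_right x))"
  proof (rule right)
    show "(\<lambda>x. h (- x)) integrable_on {a..b}" for a b
      using int[of "-b" "-a"] Henstock_Kurzweil_Integration.integrable_reflect_real[where a = "-b" and b = "-a" and f = h] by simp
    show "- P (- y) - - P (- x) = integral {x..y} (\<lambda>x. h (- x))" if "x \<le> y" for x y
      using P[of "-y" "-x"] that Henstock_Kurzweil_Integration.integral_reflect_real[where a = "-y" and b = "-x" and f = h] by simp
  qed
  then obtain N2 where N2: "negligible N2"
    and d2: "\<And>x. x \<notin> N2 \<Longrightarrow> ((\<lambda>x. - P (- x)) has_real_derivative h (- x)) (at_right x)"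
    by blast
  have "(P has_real_derivative h x) (at x)" if "x \<notin> N1 \<union> uminus ` N2" for x
  proof -
    have "- x \<notin> N2" using that by force
    from d2[OF this] have "((\<lambda>y. (- P (- y) - - P (- (- x))) / (y - - x)) \<longlongrightarrow> h x) (at_right (- x))"
      by (simp add: has_field_derivative_iff)
    then have "((\<lambda>y. (P y - P x) / (y - x)) \<longlongrightarrow> h x) (at_left x)"
      unfolding filterlim_at_left_to_right
      by (rule Lim_transform_eventually) (auto simp: eventually_at_filter divide_simps algebra_simps)
    then show ?thesis
      using d1[of x] that by (auto simp: has_field_derivative_iff filterlim_split_at_real filterlim_split_at)
  qed
  moreover have "negligible (N1 \<union> uminus ` N2)"
    using N1 N2 by (auto intro!: negligible_Un negligible_lipschitz_image[where L = 1])
  ultimately show ?thesis using that by blast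
qed

text \<open>The difference quotients are bounded by \<open>L\<close> and converge off
  \<open>N\<close>, so dominated convergence applies. The bound is local around the fixed
  \<open>\<alpha>\<close>, which lets it cover the quadratic integrand of the cost.\<close>

lemma integral_lipschitz_has_derivative:
  fixes \<Phi> :: "real \<Rightarrow> real \<Rightarrow> real"
  assumes int: "\<And>\<beta>. \<Phi> \<beta> integrable_on {a..b}"
    and lip: "\<And>\<beta> t. \<lbrakk>\<bar>\<beta> - \<alpha>\<bar> \<le> 1; t \<in> {a..b}\<rbrakk> \<Longrightarrow> \<bar>\<Phi> \<beta> t - \<Phi> \<alpha> t\<bar> \<le> L * \<bar>\<beta> - \<alpha>\<bar>"
    and N: "negligible N"
    and der: "\<And>t. \<lbrakk>t \<in> {a..b}; t \<notin> N\<rbrakk> \<Longrightarrow> ((\<lambda>\<beta>. \<Phi> \<beta> t) has_real_derivative d t) (at \<alpha>)"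
  shows "d absolutely_integrable_on {a..b}"
    and "((\<lambda>\<beta>. integral {a..b} (\<Phi> \<beta>)) has_real_derivative integral {a..b} d) (at \<alpha>)"
proof -
  \<comment> \<open>Deleting \<open>N\<close> makes the convergence hold at every point of the
    domain, without changing any integral.\<close>
  define S where "S = {a..b} - N"
  have neg: "negligible {x \<in> S - {a..b}. u x \<noteq> 0}" "negligible {x \<in> {a..b} - S. u x \<noteq> 0}"
    for u :: "real \<Rightarrow> real"
    by (auto simp: S_def intro: negligible_subset[OF N])
  have neg2: "negligible (S - {a..b} \<union> ({a..b} - S))"
    by (auto simp: S_def intro: negligible_subset[OF N])
  have toS: "u integrable_on S \<longleftrightarrow> u integrable_on {a..b}" "integral S u = integral {a..b} u"
    for u :: "real \<Rightarrow> real"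
    using integrable_spike_set_eq[OF neg2] integral_spike_set[OF neg] by auto
  have main: "d integrable_on S \<and>
      (\<lambda>k. integral S (\<lambda>t. (\<Phi> (\<alpha> + X k) t - \<Phi> \<alpha> t) / X k)) \<longlonglongrightarrow> integral S d"
    if X0: "\<And>k. X k \<noteq> 0" and X1: "\<And>k. \<bar>X k\<bar> \<le> 1" and X: "X \<longlonglongrightarrow> 0" for X :: "nat \<Rightarrow> real"
  proof -
    have "(\<lambda>t. (\<Phi> (\<alpha> + X k) t - \<Phi> \<alpha> t) / X k) integrable_on S" for k
      unfolding toS by (intro integrable_diff integrable_on_divide int)
    moreover have "(\<lambda>t. L) integrable_on S" unfolding toS by (rule integrable_const_ivl)
    moreover have "norm ((\<Phi> (\<alpha> + X k) t - \<Phi> \<alpha> t) / X k) \<le> L" if "t \<in> S" for k t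
      using lip[of "\<alpha> + X k" t] X0[of k] X1[of k] that by (simp add: S_def divide_le_eq)
    moreover have "(\<lambda>k. (\<Phi> (\<alpha> + X k) t - \<Phi> \<alpha> t) / X k) \<longlonglongrightarrow> d t" if "t \<in> S" for t
    proof -
      have "((\<lambda>h. (\<Phi> (\<alpha> + h) t - \<Phi> \<alpha> t) / h) \<longlongrightarrow> d t) (at 0)"
        using der[of t] that by (simp add: S_def DERIV_def)
      moreover have "filterlim X (at 0) sequentially"
        using X X0 by (auto simp: filterlim_at)
      ultimately show ?thesis by (rule filterlim_compose)
    qed
    ultimately show ?thesis
      using dominated_convergence[of "\<lambda>k t. (\<Phi> (\<alpha> + X k) t - \<Phi> \<alpha> t) / X k" S "\<lambda>t. L" d] by blast
  qed
  \<comment> \<open>One concrete sequence of steps suffices for the integrability of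
    \<open>d\<close>.\<close>
  have Suc_seq: "(\<lambda>k. 1 / real (Suc k)) \<longlonglongrightarrow> 0"
    by (rule LIMSEQ_Suc) (rule lim_1_over_n)
  have "d integrable_on S"
    using main[of "\<lambda>k. 1 / real (Suc k)"] Suc_seq by simp
  \<comment> \<open>As a limit of the quotients, \<open>d\<close> inherits their bound; this
    upgrades integrability to absolute integrability.\<close>
  moreover have "norm (d t) \<le> L" if "t \<in> S" for t
  proof -
    have "((\<lambda>h. (\<Phi> (\<alpha> + h) t - \<Phi> \<alpha> t) / h) \<longlongrightarrow> d t) (at 0)"
      using der[of t] that by (simp add: S_def DERIV_def)
    then have "((\<lambda>h. norm ((\<Phi> (\<alpha> + h) t - \<Phi> \<alpha> t) / h)) \<longlongrightarrow> norm (d t)) (at 0)"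
      by (rule tendsto_norm)
    then show ?thesis
    proof (rule tendsto_upperbound)
      show "\<forall>\<^sub>F h in at 0. norm ((\<Phi> (\<alpha> + h) t - \<Phi> \<alpha> t) / h) \<le> L"
        unfolding eventually_at
      proof (intro exI[of _ 1] conjI ballI impI)
        fix h :: real assume h: "h \<noteq> 0 \<and> dist h 0 < 1"
        then show "norm ((\<Phi> (\<alpha> + h) t - \<Phi> \<alpha> t) / h) \<le> L"
          using lip[of "\<alpha> + h" t] that by (simp add: S_def divide_le_eq)
      qed auto
    qed simp
  qed
  ultimately have "d absolutely_integrable_on S"
    by (intro absolutely_integrable_integrable_bound[of S d "\<lambda>t. L"]) (auto simp: toS)
  then show "d absolutely_integrable_on {a..b}"
    using neg by (rule absolutely_integrable_spike_set)
  show "((\<lambda>\<beta>. integral {a..b} (\<Phi> \<beta>)) has_real_derivative integral {a..b} d) (at \<alpha>)"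
    unfolding DERIV_def tendsto_at_iff_sequentially
  proof (intro allI impI)
    fix X :: "nat \<Rightarrow> real"
    assume X0: "\<forall>i. X i \<in> UNIV - {0}" and X: "X \<longlonglongrightarrow> 0"
    \<comment> \<open>Only a tail of \<open>X\<close> lies in the range of the Lipschitz bound; the
      limit does not see the dropped terms.\<close>
    obtain n where n: "\<And>k. k \<ge> n \<Longrightarrow> \<bar>X k\<bar> < 1"
      using X[unfolded LIMSEQ_iff, rule_format, of 1] by auto
    have "(\<lambda>k. integral S (\<lambda>t. (\<Phi> (\<alpha> + X (k + n)) t - \<Phi> \<alpha> t) / X (k + n))) \<longlonglongrightarrow> integral S d"
      using main[of "\<lambda>k. X (k + n)"] X0 LIMSEQ_ignore_initial_segment[OF X, of n] n
      by (simp add: less_imp_le)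
    then have "(\<lambda>k. integral S (\<lambda>t. (\<Phi> (\<alpha> + X k) t - \<Phi> \<alpha> t) / X k)) \<longlonglongrightarrow> integral S d"
      by (rule LIMSEQ_offset)
    then show "((\<lambda>h. (integral {a..b} (\<Phi> (\<alpha> + h)) - integral {a..b} (\<Phi> \<alpha>)) / h) \<circ> X)
        \<longlonglongrightarrow> integral {a..b} d"
      by (simp add: toS o_def int integral_diff)
  qed
qed

lemma continuous_antiderivative:
  fixes h :: "real \<Rightarrow> real"
  assumes "continuous_on UNIV h"
  obtains Q where "\<And>x. (Q has_real_derivative h x) (at x)"
proof -
  have "\<exists>Q. \<forall>x::real. - \<infinity> < ereal x \<longrightarrow> ereal x < \<infinity> \<longrightarrow> (Q has_vector_derivative h x) (at x)"
    using assms by (intro einterval_antiderivative) (auto simp: continuous_on_eq_continuous_at)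
  then show ?thesis using that by (auto simp: has_real_derivative_iff_has_vector_derivative)
qed

lemma integral_eq_antiderivative_diff:
  fixes h Q :: "real \<Rightarrow> real"
  assumes "a \<le> b" and "\<And>x. (Q has_real_derivative h x) (at x)"
  shows "integral {a..b} h = Q b - Q a"
  using assms
  by (intro integral_unique fundamental_theorem_of_calculus)
    (auto simp: has_real_derivative_iff_has_vector_derivative has_vector_derivative_at_within)

section \<open>Convexity and minimizers from a strictly increasing derivative\<close>

text \<open>The mean value theorem on both sides of \<open>z = u * x + v * y\<close> gives slopes
  \<open>h' \<xi> < h' \<zeta>\<close>. After weighting by \<open>u\<close> and \<open>v\<close>
  both increments carry the common factor \<open>u * v * (y - x)\<close>.\<close>

lemma strictly_convex_on_UNIV_derivative:
  fixes h h' :: "real \<Rightarrow> real"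
  assumes der: "\<And>x. (h has_real_derivative h' x) (at x)" and mono: "strict_mono h'"
  shows "strictly_convex_on UNIV h"
proof -
  have lt: "h (u * x + v * y) < u * h x + v * h y"
    if "x < y" "0 < u" "0 < v" "u + v = 1" for x y u v
  proof -
    define z where "z = u * x + v * y"
    have zx: "z - x = v * (y - x)" and yz: "y - z = u * (y - x)"
      using \<open>u + v = 1\<close> unfolding z_def by algebra+
    have "x < z" "z < y"
      using zx yz that by (metis diff_gt_0_iff_gt mult_pos_pos)+
    obtain \<xi> where \<xi>: "\<xi> < z" "h z - h x = (z - x) * h' \<xi>"
      using MVT2[OF \<open>x < z\<close>] der by blast
    obtain \<zeta> where \<zeta>: "z < \<zeta>" "h y - h z = (y - z) * h' \<zeta>"
      using MVT2[OF \<open>z < y\<close>] der by blast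
    have "h' \<xi> < h' \<zeta>" using \<xi>(1) \<zeta>(1) by (intro strict_monoD[OF mono]) simp
    then have "(u * v * (y - x)) * h' \<xi> < (u * v * (y - x)) * h' \<zeta>"
      using that by (intro mult_strict_left_mono) auto
    then have "u * (h z - h x) < v * (h y - h z)"
      unfolding \<xi>(2) \<zeta>(2) zx yz by (simp add: ac_simps)
    then have "(u + v) * h z < u * h x + v * h y" by (simp add: algebra_simps)
    then show ?thesis using \<open>u + v = 1\<close> by (simp add: z_def)
  qed
  show ?thesis
    unfolding strictly_convex_on_def
  proof (intro conjI ballI allI impI)
    fix x y u v :: real
    assume "x \<noteq> y" "0 < u" "0 < v" "u + v = 1"
    then show "h (u * x + v * y) < u * h x + v * h y"
      using lt[of x y u v] lt[of y x v u] by (cases "x < y") (auto simp: add.commute)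
  qed simp
qed

text \<open>The zero of \<open>h'\<close> given by the intermediate value theorem separates negative
  from positive values of \<open>h'\<close> on the whole line, so it is a strict global minimum. The
  signs at \<open>a\<close> and \<open>b\<close> keep it off the endpoints.\<close>

lemma unique_minimum_derivative:
  fixes h h' :: "real \<Rightarrow> real"
  assumes der: "\<And>x. (h has_real_derivative h' x) (at x)" and mono: "strict_mono h'"
    and cont: "continuous_on {a..b} h'" and "a \<le> b" "h' a < 0" "0 < h' b"
  shows "\<exists>x\<in>{a<..<b}. {y. \<forall>z. h y \<le> h z} = {x}"
proof -
  obtain x where x: "a \<le> x" "x \<le> b" "h' x = 0"
    using IVT'[of h' a 0 b] assms by auto
  have min: "h x < h z" if "z \<noteq> x" for z
  proof (cases "x < z")
    case True
    obtain \<xi> where "x < \<xi>" "h z - h x = (z - x) * h' \<xi>" using MVT2[OF True] der by blast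
    moreover have "0 < h' \<xi>" using strict_monoD[OF mono \<open>x < \<xi>\<close>] x by simp
    ultimately show ?thesis using True by (metis diff_gt_0_iff_gt mult_pos_pos)
  next
    case False
    then have "z < x" using that by simp
    obtain \<xi> where "\<xi> < x" "h x - h z = (x - z) * h' \<xi>" using MVT2[OF \<open>z < x\<close>] der by blast
    moreover have "h' \<xi> < 0" using strict_monoD[OF mono \<open>\<xi> < x\<close>] x by simp
    ultimately show ?thesis using \<open>z < x\<close> by (metis diff_gt_0_iff_gt diff_less_0_iff_less mult_pos_neg)
  qed
  have "{y. \<forall>z. h y \<le> h z} = {x}"
  proof (intro set_eqI iffI CollectI allI)
    fix y assume "y \<in> {y. \<forall>z. h y \<le> h z}"
    then have "h y \<le> h x" by simp
    then show "y \<in> {x}" using min[of y] by (cases "y = x") auto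
  next
    fix y z assume "y \<in> {x}"
    then show "h y \<le> h z" using min[of z] by (cases "z = x") auto
  qed
  moreover have "x \<in> {a<..<b}"
    using x assms by (metis greaterThanLessThan_iff less_irrefl order_le_less)
  ultimately show ?thesis by blast
qed

subsection \<open>Densities on the circle\<close>

text \<open>Puts the almost-everywhere bound into the form of a negligible set, in which exceptional
  sets are united and mapped by \<open>F\<close> later.\<close>

lemma circle_densityE:
  assumes "f \<in> circle_densities"
  obtains \<eta> where "0 < \<eta>" "negligible {t. f t < \<eta>}"
proof -
  obtain \<eta> where \<eta>: "\<eta> > 0" "AE t in lebesgue. \<eta> \<le> f t"
    using assms by (auto simp: circle_densities_def)
  from AE_E[OF \<eta>(2)] obtain N
    where "{t \<in> space lebesgue. \<not> \<eta> \<le> f t} \<subseteq> N" "emeasure lebesgue N = 0" "N \<in> sets lebesgue" .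
  then have "negligible N" "{t. f t < \<eta>} \<subseteq> N"
    by (auto simp: negligible_iff_null_sets null_sets_def not_le)
  then have "negligible {t. f t < \<eta>}" by (rule negligible_subset)
  with \<eta>(1) show ?thesis by (rule that)
qed

section \<open>The distribution function and its inverse\<close>

locale circle_density =
  fixes f :: "real \<Rightarrow> real" and \<eta> :: real
  assumes density: "f \<in> circle_densities"
    and eta_pos: "0 < \<eta>" and eta_le: "negligible {t. f t < \<eta>}"
begin

abbreviation "F \<equiv> circle_cdf f"
abbreviation "Finv \<equiv> inverse_dist F"

lemma integrable: "f integrable_on {a..b}"
  by (rule periodic_integrable_on)
    (use density in \<open>auto simp: circle_densities_def absolutely_integrable_on_def\<close>)

lemma cdf_diff: "x \<le> y \<Longrightarrow> F y - F x = integral {x..y} f"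
  using periodic_integral_primitive[of f x y] density integrable[of 0 1]
  by (simp add: circle_densities_def circle_cdf_def)

text \<open>On a null set \<open>f\<close> may drop below \<open>\<eta>\<close>. The maximum
  satisfies the bound at every point and has the same integrals, so pointwise comparison becomes
  available.\<close>

lemma integral_max: "(\<lambda>t. max (f t) \<eta>) integrable_on {a..b}"
  "integral {a..b} (\<lambda>t. max (f t) \<eta>) = integral {a..b} f"
  using eta_le integrable[of a b]
  by (auto intro!: integral_spike[of "{t. f t < \<eta>}"] intro: integrable_spike[of f "{a..b}" "{t. f t < \<eta>}"])

text \<open>Read backwards, this slope bound is the Lipschitz constant \<open>1 / \<eta>\<close> of
  \<open>Finv\<close>.\<close>

lemma cdf_growth:
  assumes "x \<le> y" shows "\<eta> * (y - x) \<le> F y - F x"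
proof -
  have "integral {x..y} (\<lambda>_. \<eta>) \<le> integral {x..y} (\<lambda>t. max (f t) \<eta>)"
    by (intro integral_le integral_max) auto
  then show ?thesis using assms by (simp add: cdf_diff integral_max algebra_simps)
qed

lemma cdf_strict_mono: "strict_mono F"
proof (rule strict_monoI)
  fix x y :: real assume "x < y"
  then have "0 < \<eta> * (y - x)" using eta_pos by simp
  also have "\<dots> \<le> F y - F x" using \<open>x < y\<close> by (intro cdf_growth) simp
  finally show "F x < F y" by simp
qed

lemma cdf_of_int: "F (of_int k) = of_int k"
  by (simp add: circle_cdf_def)

lemma cdf_continuous: "continuous_on UNIV F"
proof -
  have "isCont F x" for x
  proof -
    have "continuous_on {x - 1..x + 1} (\<lambda>y. F (x - 1) + integral {x - 1..y} f)"
      by (intro continuous_intros indefinite_integral_continuous_1 integrable)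
    then have "continuous_on {x - 1..x + 1} F"
      by (rule continuous_on_eq) (simp flip: cdf_diff)
    then show ?thesis by (rule continuous_on_interior) simp
  qed
  then show ?thesis by (simp add: continuous_at_imp_continuous_on)
qed

text \<open>By strict monotonicity the set under the infimum is the open ray
  \<open>{t<..}\<close>.\<close>

lemma Finv_cdf [simp]: "Finv (F t) = t"
  using cdf_strict_mono by (simp add: inverse_dist_def strict_mono_less flip: greaterThan_def)

text \<open>Surjectivity: \<open>F\<close> is continuous and fixes every integer, so it takes the
  value \<open>y\<close> between \<open>\<lfloor>y\<rfloor>\<close> and
  \<open>\<lfloor>y\<rfloor> + 1\<close>.\<close>

lemma cdf_Finv [simp]: "F (Finv y) = y"
proof -
  have "\<exists>t. of_int \<lfloor>y\<rfloor> \<le> t \<and> t \<le> of_int (\<lfloor>y\<rfloor> + 1) \<and> F t = y"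
    by (rule IVT') (use cdf_of_int cdf_continuous in \<open>auto simp del: of_int_add intro: continuous_on_subset, linarith+\<close>)
  then show ?thesis using Finv_cdf by metis
qed

lemma Finv_add_one: "Finv (y + 1) = Finv y + 1"
  by (metis Finv_cdf cdf_Finv circle_cdf_add_one)

lemma Finv_less_iff: "Finv x < Finv y \<longleftrightarrow> x < y"
  using strict_mono_less[OF cdf_strict_mono, of "Finv x" "Finv y"] by simp

lemma Finv_lipschitz: "\<bar>Finv x - Finv y\<bar> \<le> 1 / \<eta> * \<bar>x - y\<bar>"
proof -
  have "\<bar>Finv x - Finv y\<bar> \<le> 1 / \<eta> * \<bar>x - y\<bar>" if "x \<le> y" for x y
  proof -
    have "Finv x \<le> Finv y" using Finv_less_iff[of y x] that by linarith
    then show ?thesis using cdf_growth[of "Finv x" "Finv y"] eta_pos that by (simp add: field_simps)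
  qed
  from this[of x y] this[of y x] show ?thesis by (metis abs_minus_commute linear)
qed

lemma Finv_continuous: "continuous_on UNIV Finv"
proof (rule lipschitz_on_continuous_on)
  show "(1 / \<eta>)-lipschitz_on UNIV Finv"
    using Finv_lipschitz eta_pos by (auto simp: lipschitz_on_def dist_real_def)
qed

lemma Finv_of_int: "Finv (of_int k) = of_int k"
  by (metis Finv_cdf cdf_of_int)

lemma Finv_range: "y \<in> {of_int j..of_int k} \<Longrightarrow> Finv y \<in> {of_int j..of_int k}"
  using Finv_less_iff[of y "of_int j"] Finv_less_iff[of "of_int k" y] by (auto simp: Finv_of_int)

section \<open>Absolute continuity of the distribution function\<close>

lemma lebesgue_measurable: "f \<in> borel_measurable lebesgue"
proof (rule borel_measurable_LIMSEQ_real)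
  fix n :: nat
  show "(\<lambda>x. if x \<in> {- real n..real n} then f x else 0) \<in> borel_measurable lebesgue"
    using integrable_imp_measurable[OF integrable[of "- real n" "real n"]]
    by (subst borel_measurable_if) auto
next
  fix x :: real
  obtain m where "\<bar>x\<bar> \<le> real m" using real_arch_simple by auto
  then have "\<forall>\<^sub>F n in sequentially. (if x \<in> {- real n..real n} then f x else 0) = f x"
    by (intro eventually_sequentiallyI[of m]) auto
  then show "(\<lambda>n. if x \<in> {- real n..real n} then f x else 0) \<longlonglongrightarrow> f x"
    by (rule tendsto_eventually)
qed

lemma cdf_measurable: "F \<in> borel_measurable lebesgue"
  using cdf_continuous by (simp add: borel_measurable_continuous_onI measurable_completion)

text \<open>The maximum equals \<open>f\<close> almost everywhere; \<open>ennreal\<close> would truncate negative values. Reading the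
  identity on null sets gives the absolute continuity of \<open>F\<close>.\<close>

lemma lborel_eq_distr_cdf:
  "lborel = distr (density lebesgue (\<lambda>t. ennreal (max (f t) \<eta>))) borel F"
proof (rule lborel_eqI)
  fix l u :: real
  assume "\<And>b. b \<in> Basis \<Longrightarrow> l \<bullet> b \<le> u \<bullet> b"
  then have "l \<le> u" by simp
  note [measurable] = cdf_measurable lebesgue_measurable
  let ?h = "\<lambda>t. max (f t) \<eta>" and ?S = "{Finv l<..<Finv u}"
  have vim: "F -` box l u = ?S"
  proof (rule set_eqI)
    fix t show "t \<in> F -` box l u \<longleftrightarrow> t \<in> ?S"
      using Finv_less_iff[of l "F t"] Finv_less_iff[of "F t" u] by simp
  qed
  have le: "Finv l \<le> Finv u" using Finv_less_iff[of u l] \<open>l \<le> u\<close> by linarith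
  \<comment> \<open>The mass between the two endpoints is
    \<open>F (Finv u) - F (Finv l) = u - l\<close>.\<close>
  have "(?h has_integral (u - l)) {Finv l..Finv u}"
    using integral_max[of "Finv l" "Finv u"] cdf_diff[OF le] by (simp add: has_integral_iff)
  then have "(?h has_integral (u - l)) ?S"
    by (rule has_integral_Icc_iff_Ioo[THEN iffD1])
  then have "((\<lambda>t. if t \<in> ?S then ?h t else 0) has_integral (u - l)) UNIV"
    by (simp only: has_integral_restrict_UNIV)
  then have "(\<integral>\<^sup>+t. ennreal (if t \<in> ?S then ?h t else 0) \<partial>lebesgue) = ennreal (u - l)"
    using eta_pos by (subst (asm) has_integral_iff_nn_integral_lebesgue) auto
  also have "(\<integral>\<^sup>+t. ennreal (if t \<in> ?S then ?h t else 0) \<partial>lebesgue)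
      = (\<integral>\<^sup>+t. ennreal (?h t) * indicator ?S t \<partial>lebesgue)"
    by (intro nn_integral_cong) auto
  also have "\<dots> = emeasure (density lebesgue (\<lambda>t. ennreal (?h t))) ?S"
    by (rule emeasure_density[symmetric]) auto
  also have "\<dots> = emeasure (distr (density lebesgue (\<lambda>t. ennreal (?h t))) borel F) (box l u)"
    by (subst emeasure_distr) (auto simp: vim[unfolded box_real])
  finally show "emeasure (distr (density lebesgue (\<lambda>t. ennreal (?h t))) borel F) (box l u) =
      ennreal (\<Prod>b\<in>Basis. (u - l) \<bullet> b)"
    by simp
qed simp

text \<open>Since \<open>f\<close> may be unbounded, \<open>F\<close> is in general not Lipschitz.
  Instead, the measure of the image is the integral of the density over the null set.\<close>

lemma negligible_cdf_image:
  assumes "negligible N" shows "negligible (F ` N)"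
proof -
  \<comment> \<open>The push-forward identity is one of Borel measures, so \<open>N\<close> is first
    enlarged to a Borel null set.\<close>
  obtain N' where N': "N' \<in> null_sets lborel" "N \<subseteq> N'"
    using assms by (auto simp: negligible_iff_null_sets null_sets_completion_iff2)
  note [measurable] = cdf_measurable lebesgue_measurable
  have [measurable]: "Finv \<in> borel_measurable borel"
    using Finv_continuous by (rule borel_measurable_continuous_onI)
  have [measurable]: "N' \<in> sets borel" using N' by auto
  \<comment> \<open>As \<open>F\<close> is a bijection, the image is a preimage under the continuous
    \<open>Finv\<close>, hence Borel.\<close>
  have im: "F ` N' = Finv -` N'" by (force simp: image_iff intro: cdf_Finv[symmetric])
  have meas: "Finv -` N' \<in> sets borel" using measurable_sets_borel[of Finv borel N'] by simp
  have null: "N' \<in> null_sets lebesgue" using N'(1) by (rule null_sets_completionI)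
  have "emeasure lborel (Finv -` N') =
      emeasure (distr (density lebesgue (\<lambda>t. ennreal (max (f t) \<eta>))) borel F) (Finv -` N')"
    by (subst lborel_eq_distr_cdf) (rule refl)
  also have "\<dots> = emeasure (density lebesgue (\<lambda>t. ennreal (max (f t) \<eta>))) N'"
    by (subst emeasure_distr) (use meas in \<open>simp_all add: vimage_def\<close>)
  also have "\<dots> = (\<integral>\<^sup>+t\<in>N'. ennreal (max (f t) \<eta>) \<partial>lebesgue)"
    by (rule emeasure_density) (use null in auto)
  also have "\<dots> = 0" using null by (rule nn_integral_null_set)
  finally have "F ` N' \<in> null_sets lborel"
    unfolding im using meas by (intro null_setsI) auto
  then have "negligible (F ` N')"
    by (simp add: negligible_iff_null_sets null_sets_completionI)
  then show ?thesis using N' by (meson image_mono negligible_subset)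
qed

text \<open>The preimage is the image of \<open>N\<close> under the Lipschitz map
  \<open>\<lambda>y. Finv (y - \<alpha>)\<close>.\<close>

lemma negligible_vimage_cdf:
  assumes "negligible N" shows "negligible ((\<lambda>t. F t + \<alpha>) -` N)"
proof -
  have "negligible ((\<lambda>y. Finv (y - \<alpha>)) ` N)"
    using Finv_lipschitz[of "x - \<alpha>" "y - \<alpha>" for x y]
    by (intro negligible_lipschitz_image[of _ "1 / \<eta>"] assms) simp
  moreover have "(\<lambda>t. F t + \<alpha>) -` N \<subseteq> (\<lambda>y. Finv (y - \<alpha>)) ` N"
    by (auto simp: image_iff intro!: bexI[where x = "F _ + \<alpha>"])
  ultimately show ?thesis by (rule negligible_subset)
qed

section \<open>Derivative of the inverse and change of variables\<close>

lemma Finv_has_derivative_ae: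
  obtains M where "negligible M"
    "\<And>y. y \<notin> M \<Longrightarrow> (Finv has_real_derivative 1 / f (Finv y)) (at y)"
proof -
  obtain N where N: "negligible N" "\<And>x. x \<notin> N \<Longrightarrow> (F has_real_derivative f x) (at x)"
    using indefinite_integral_has_derivative_ae[of f F] integrable cdf_diff by metis
  \<comment> \<open>The bad points of \<open>F\<close> are carried to the \<open>y\<close> side,
    where absolute continuity keeps them null. Including the points with \<open>f t < \<eta>\<close>
    ensures a nonzero derivative for the inverse function rule.\<close>
  let ?M = "F ` (N \<union> {t. f t < \<eta>})"
  show ?thesis
  proof
    show "negligible ?M" by (intro negligible_cdf_image negligible_Un N eta_le)
    fix y assume "y \<notin> ?M"
    then have y: "Finv y \<notin> N" "\<not> f (Finv y) < \<eta>"
      by (metis UnI1 UnI2 cdf_Finv imageI mem_Collect_eq)+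
    have "(Finv has_real_derivative inverse (f (Finv y))) (at y)"
      by (rule DERIV_inverse_function[where f = F and g = Finv and x = y and a = "y - 1" and b = "y + 1", OF N(2)[OF y(1)]])
        (use y eta_pos Finv_continuous in \<open>auto simp: continuous_on_eq_continuous_at\<close>)
    then show "(Finv has_real_derivative 1 / f (Finv y)) (at y)" by (simp add: inverse_eq_divide)
  qed
qed

lemma continuous_on_cdf_comp [continuous_intros]:
  "continuous_on S u \<Longrightarrow> continuous_on S (\<lambda>x. F (u x))"
  by (rule continuous_on_compose2[OF cdf_continuous]) auto

lemma continuous_on_Finv_comp [continuous_intros]:
  "continuous_on S u \<Longrightarrow> continuous_on S (\<lambda>x. Finv (u x))"
  by (rule continuous_on_compose2[OF Finv_continuous]) auto

lemma density_Finv_add_one: "f (Finv (y + 1)) = f (Finv y)"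
  using density by (simp add: Finv_add_one circle_densities_def)

text \<open>Both sides are the increment over a period of \<open>y \<mapsto> Q (Finv y)\<close>, \<open>Q' = \<psi> \<circ> F\<close>, which is only
  Lipschitz: its average over \<open>[\<beta>, \<beta> + 1]\<close> is differentiated at \<open>\<beta> = 0\<close> in two ways.\<close>

lemma integral_density_substitution:
  assumes cont: "continuous_on UNIV \<psi>"
  shows "integral {0..1} (\<lambda>y. \<psi> y / f (Finv y)) = integral {0..1} (\<lambda>t. \<psi> (F t))"
proof -
  have contF: "continuous_on UNIV (\<lambda>t. \<psi> (F t))"
    by (rule continuous_on_compose2[OF cont cdf_continuous]) simp
  obtain Q where Q: "\<And>x. (Q has_real_derivative \<psi> (F x)) (at x)"
    using continuous_antiderivative[OF contF] by blast
  define P where "P = (\<lambda>y. Q (Finv y))"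
  have contP: "continuous_on UNIV P"
    unfolding P_def
    by (intro continuous_on_compose2[OF DERIV_continuous_on[of UNIV Q] Finv_continuous]) (use Q in auto)
  obtain R where R: "\<And>x. (R has_real_derivative P x) (at x)"
    using continuous_antiderivative[OF contP] by blast
  obtain M where M: "negligible M"
    "\<And>y. y \<notin> M \<Longrightarrow> (Finv has_real_derivative 1 / f (Finv y)) (at y)"
    using Finv_has_derivative_ae by metis
  \<comment> \<open>The interval contains \<open>y + \<beta>\<close> for \<open>y\<close> in
    \<open>[0,1]\<close> and \<open>\<bar>\<beta>\<bar> \<le> 1\<close>. Its endpoints are integers,
    so \<open>Finv\<close> maps it into itself.\<close>
  have "compact ((\<lambda>t. \<psi> (F t)) ` {-1..2})"
    by (intro compact_continuous_image continuous_on_subset[OF contF]) auto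
  then obtain B where "\<forall>x\<in>(\<lambda>t. \<psi> (F t)) ` {-1..2}. norm x \<le> B"
    using compact_imp_bounded bounded_iff by metis
  then have B: "norm (\<psi> (F t)) \<le> B" if "t \<in> {-1..2}" for t
    using that by blast
  have "0 \<le> B" using B[of 0] by (auto intro: order_trans[OF norm_ge_zero])
  have lipQ: "\<bar>Q x - Q y\<bar> \<le> B * \<bar>x - y\<bar>" if "x \<in> {-1..2}" "y \<in> {-1..2}" for x y
    using field_differentiable_bound[of "{-1..2}" Q "\<lambda>t. \<psi> (F t)" B x y] B Q that
    by (auto intro: has_field_derivative_at_within)
  have lipP: "\<bar>P (y + \<beta>) - P (y + 0)\<bar> \<le> B * (1 / \<eta>) * \<bar>\<beta> - 0\<bar>"
    if "\<bar>\<beta> - 0\<bar> \<le> 1" "y \<in> {0..1}" for \<beta> y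
  proof -
    have "y + \<beta> \<in> {-1..2}" "y + 0 \<in> {-1..2}" using that by auto
    then have "\<bar>P (y + \<beta>) - P (y + 0)\<bar> \<le> B * \<bar>Finv (y + \<beta>) - Finv (y + 0)\<bar>"
      unfolding P_def using Finv_range[of _ "-1" 2] by (intro lipQ) simp_all
    also have "\<dots> \<le> B * (1 / \<eta> * \<bar>\<beta>\<bar>)"
      using Finv_lipschitz[of "y + \<beta>" "y + 0"] \<open>0 \<le> B\<close> by (intro mult_left_mono) auto
    finally show ?thesis by simp
  qed
  \<comment> \<open>First way: under the integral sign, with the chain rule valid off
    \<open>M\<close>.\<close>
  have "((\<lambda>\<beta>. integral {0..1} (\<lambda>y. P (y + \<beta>))) has_real_derivative
      integral {0..1} (\<lambda>y. \<psi> y / f (Finv y))) (at 0)"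
  proof (rule integral_lipschitz_has_derivative(2)[OF _ lipP M(1)])
    show "(\<lambda>y. P (y + \<beta>)) integrable_on {0..1}" for \<beta>
      by (intro integrable_continuous_real continuous_on_compose2[OF contP] continuous_intros) auto
    show "((\<lambda>\<beta>. P (y + \<beta>)) has_real_derivative \<psi> y / f (Finv y)) (at 0)" if "y \<notin> M" for y
    proof -
      have "(P has_real_derivative \<psi> (F (Finv y)) * (1 / f (Finv y))) (at y)"
        unfolding P_def by (rule DERIV_chain2[OF Q M(2)[OF that]])
      then show ?thesis using DERIV_shift[of P _ 0 y] by (simp add: add.commute)
    qed
  qed auto
  \<comment> \<open>Second way: a moving window over the continuous \<open>P\<close>, so only its
    endpoints contribute.\<close>
  moreover have "(\<lambda>\<beta>. integral {0..1} (\<lambda>y. P (y + \<beta>))) = (\<lambda>\<beta>. R (\<beta> + 1) - R \<beta>)"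
  proof
    fix \<beta>
    have "integral {0..1} (\<lambda>y. P (y + \<beta>)) = integral {\<beta>..\<beta> + 1} P"
      using integral_shift_Icc_real[of 0 1 P \<beta>] by (simp add: o_def add.commute)
    then show "integral {0..1} (\<lambda>y. P (y + \<beta>)) = R (\<beta> + 1) - R \<beta>"
      using integral_eq_antiderivative_diff[OF _ R] by simp
  qed
  moreover have "((\<lambda>\<beta>. R (\<beta> + 1) - R \<beta>) has_real_derivative P 1 - P 0) (at 0)"
    using R[of 1] DERIV_shift[of R "P 1" 0 1] by (intro DERIV_diff R) simp
  ultimately have "integral {0..1} (\<lambda>y. \<psi> y / f (Finv y)) = P 1 - P 0"
    using DERIV_unique by metis
  also have "\<dots> = integral {0..1} (\<lambda>t. \<psi> (F t))"
    using integral_eq_antiderivative_diff[OF _ Q, of 0 1] Finv_of_int[of 0] Finv_of_int[of 1]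
    by (simp add: P_def)
  finally show ?thesis .
qed

end

subsection \<open>The cost of two densities\<close>

locale circle_density_pair = f: circle_density f \<eta> + g: circle_density g \<theta>
  for f g :: "real \<Rightarrow> real" and \<eta> \<theta> :: real
begin

text \<open>The average of the increasing map that carries \<open>g\<close> to \<open>f\<close> with
  offset \<open>\<alpha>\<close> between the distribution functions. It will turn out that the cost
  has derivative \<open>2 * transport_mean \<alpha> - 1\<close>.\<close>

definition transport_mean :: "real \<Rightarrow> real" where
  "transport_mean \<alpha> = integral {0..1} (\<lambda>t. f.Finv (g.F t + \<alpha>))"

text \<open>The exceptional set of \<open>t\<close> varies with \<open>\<alpha>\<close> but is null
  for each one, so the derivative exists at every \<open>\<alpha>\<close>.\<close>

lemma transport_mean_has_derivative:
  shows "(\<lambda>t. 1 / f (f.Finv (g.F t + \<alpha>))) absolutely_integrable_on {0..1}"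
    and "(transport_mean has_real_derivative integral {0..1} (\<lambda>t. 1 / f (f.Finv (g.F t + \<alpha>)))) (at \<alpha>)"
proof -
  obtain M where M: "negligible M"
    "\<And>y. y \<notin> M \<Longrightarrow> (f.Finv has_real_derivative 1 / f (f.Finv y)) (at y)"
    using f.Finv_has_derivative_ae by metis
  have int: "(\<lambda>t. f.Finv (g.F t + \<beta>)) integrable_on {0..1}" for \<beta>
    by (intro integrable_continuous_real continuous_intros)
  have lip: "\<bar>f.Finv (g.F t + \<beta>) - f.Finv (g.F t + \<alpha>)\<bar> \<le> 1 / \<eta> * \<bar>\<beta> - \<alpha>\<bar>" for t \<beta>
    using f.Finv_lipschitz[of "g.F t + \<beta>" "g.F t + \<alpha>"] by simp
  have der: "((\<lambda>\<beta>. f.Finv (g.F t + \<beta>)) has_real_derivative 1 / f (f.Finv (g.F t + \<alpha>))) (at \<alpha>)"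
    if "t \<notin> (\<lambda>t. g.F t + \<alpha>) -` M" for t
    using M(2)[of "g.F t + \<alpha>"] that DERIV_shift[of f.Finv _ \<alpha> "g.F t"]
    by (simp add: add.commute)
  note * = integral_lipschitz_has_derivative[where N = "(\<lambda>t. g.F t + \<alpha>) -` M"
      and \<Phi> = "\<lambda>\<beta> t. f.Finv (g.F t + \<beta>)", OF int lip g.negligible_vimage_cdf[OF M(1)] der]
  show "(\<lambda>t. 1 / f (f.Finv (g.F t + \<alpha>))) absolutely_integrable_on {0..1}"
    by (rule *(1))
  show "(transport_mean has_real_derivative integral {0..1} (\<lambda>t. 1 / f (f.Finv (g.F t + \<alpha>)))) (at \<alpha>)"
    using *(2) by (simp add: transport_mean_def[abs_def])
qed

lemma transport_mean_strict_mono: "strict_mono transport_mean"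
  unfolding transport_mean_def
  by (intro strict_monoI integral_less_real) (auto intro!: continuous_intros simp: f.Finv_less_iff)

text \<open>\<open>Finv (G t)\<close> lies in \<open>[0,1]\<close> and an offset of 1 moves it by
  exactly 1. Hence the derivative of the cost is at most -1 at \<open>-1\<close> and at least 1 at
  \<open>1\<close>.\<close>

lemma transport_mean_bounds: "transport_mean (-1) \<le> 0" "1 \<le> transport_mean 1"
proof -
  have range: "f.Finv (g.F t) \<in> {0..1}" if "t \<in> {0..1}" for t
  proof -
    have "g.F t \<in> {0..1}"
      using that strict_mono_less_eq[OF g.cdf_strict_mono, of 0 t]
        strict_mono_less_eq[OF g.cdf_strict_mono, of t 1] g.cdf_of_int[of 0] g.cdf_of_int[of 1]
      by auto
    then show ?thesis using f.Finv_range[of "g.F t" 0 1] by simp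
  qed
  have "transport_mean (-1) \<le> integral {0..1} (\<lambda>t::real. 0)"
    unfolding transport_mean_def
  proof (rule integral_le)
    show "f.Finv (g.F t + - 1) \<le> 0" if "t \<in> {0..1}" for t
      using range[OF that] f.Finv_add_one[of "g.F t - 1"] by simp
  qed (auto intro!: integrable_continuous_real continuous_intros)
  then show "transport_mean (-1) \<le> 0" by simp
  have "integral {0..1} (\<lambda>t::real. 1) \<le> transport_mean 1"
    unfolding transport_mean_def
  proof (rule integral_le)
    show "1 \<le> f.Finv (g.F t + 1)" if "t \<in> {0..1}" for t
      using range[OF that] f.Finv_add_one[of "g.F t"] by simp
  qed (auto intro!: integrable_continuous_real continuous_intros)
  then show "1 \<le> transport_mean 1" by simp
qed

section \<open>First and second derivative of the cost\<close>

lemma circle_cost_eq: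
  "circle_cost f g \<alpha> = integral {0..1} (\<lambda>t. (f.Finv t - g.Finv (t - \<alpha>))\<^sup>2)"
  by (simp add: circle_cost_def inverse_dist_shift)

text \<open>Both inverses grow by 1 over a period, so the integrand is periodic and \<open>t\<close>
  may be replaced by \<open>t + \<alpha>\<close>. This moves the offset from \<open>g\<close> to
  \<open>f\<close>.\<close>

lemma circle_cost_swap: "circle_cost f g \<alpha> = circle_cost g f (- \<alpha>)"
proof -
  interpret swap: circle_density_pair g f \<theta> \<eta> ..
  have "integral {0..1} (\<lambda>t. (f.Finv (t + \<alpha>) - g.Finv (t + \<alpha> - \<alpha>))\<^sup>2)
      = integral {0..1} (\<lambda>t. (f.Finv t - g.Finv (t - \<alpha>))\<^sup>2)"
    using f.Finv_add_one g.Finv_add_one[of "t - \<alpha>" for t]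
    by (intro periodic_integral_shift integrable_continuous_real continuous_intros)
      (simp add: algebra_simps)
  then show ?thesis
    by (simp add: circle_cost_eq swap.circle_cost_eq power2_commute)
qed

text \<open>Only \<open>g.Finv (t - \<alpha>)\<close> is differentiated. A shift by
  \<open>\<alpha>\<close> over a period and the substitution \<open>y = G t\<close> then remove the
  factor \<open>1 / g\<close>.\<close>

lemma circle_cost_has_derivative:
  "(circle_cost f g has_real_derivative 2 * transport_mean \<alpha> - 1) (at \<alpha>)"
proof -
  \<comment> \<open>Chosen so that the integrand of the cost has derivative
    \<open>\<psi> (t - \<alpha>) / g (g.Finv (t - \<alpha>))\<close>, a function of
    \<open>t - \<alpha>\<close> alone.\<close>
  define \<psi> where "\<psi> y = 2 * (f.Finv (y + \<alpha>) - g.Finv y)" for y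
  define d where "d t = \<psi> (t - \<alpha>) / g (g.Finv (t - \<alpha>))" for t
  obtain M where M: "negligible M"
    "\<And>y. y \<notin> M \<Longrightarrow> (g.Finv has_real_derivative 1 / g (g.Finv y)) (at y)"
    using g.Finv_has_derivative_ae by metis
  have int: "(\<lambda>t. (f.Finv t - g.Finv (t - \<beta>))\<^sup>2) integrable_on {0..1}" for \<beta>
    by (intro integrable_continuous_real continuous_intros)
  \<comment> \<open>Bounds \<open>g.Finv (t - \<gamma>)\<close>: it vanishes at 0, and
    \<open>\<bar>t - \<gamma>\<bar> \<le> 1 + (\<bar>\<alpha>\<bar> + 1)\<close>.\<close>
  define C where "C = 1 / \<theta> * (\<bar>\<alpha>\<bar> + 2)"
  \<comment> \<open>A square is only locally Lipschitz. The difference of squares is factored, and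
    the sum factor is at most \<open>2 + 2 * C\<close> because \<open>f.Finv t\<close> lies in
    \<open>[0,1]\<close>.\<close>
  have lip: "\<bar>(f.Finv t - g.Finv (t - \<beta>))\<^sup>2 - (f.Finv t - g.Finv (t - \<alpha>))\<^sup>2\<bar>
      \<le> 1 / \<theta> * (2 + 2 * C) * \<bar>\<beta> - \<alpha>\<bar>" if "\<bar>\<beta> - \<alpha>\<bar> \<le> 1" "t \<in> {0..1}" for t \<beta>
  proof -
    have bd: "\<bar>g.Finv (t - \<gamma>)\<bar> \<le> C" if "\<bar>\<gamma> - \<alpha>\<bar> \<le> 1" for \<gamma>
    proof -
      have "\<bar>g.Finv (t - \<gamma>)\<bar> \<le> 1 / \<theta> * \<bar>t - \<gamma>\<bar>"
        using g.Finv_lipschitz[of "t - \<gamma>" 0] g.Finv_of_int[of 0] by simp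
      also have "\<dots> \<le> C"
        unfolding C_def using that \<open>t \<in> {0..1}\<close> g.eta_pos by (intro mult_left_mono) auto
      finally show ?thesis .
    qed
    have "\<bar>2 * f.Finv t - g.Finv (t - \<beta>) - g.Finv (t - \<alpha>)\<bar> \<le> 2 + 2 * C"
      using bd[of \<alpha>] bd[of \<beta>] that f.Finv_range[of t 0 1] by auto
    moreover have "\<bar>g.Finv (t - \<alpha>) - g.Finv (t - \<beta>)\<bar> \<le> 1 / \<theta> * \<bar>\<beta> - \<alpha>\<bar>"
      using g.Finv_lipschitz[of "t - \<alpha>" "t - \<beta>"] by simp
    ultimately have "\<bar>g.Finv (t - \<alpha>) - g.Finv (t - \<beta>)\<bar> * \<bar>2 * f.Finv t - g.Finv (t - \<beta>) - g.Finv (t - \<alpha>)\<bar>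
        \<le> (1 / \<theta> * \<bar>\<beta> - \<alpha>\<bar>) * (2 + 2 * C)"
      using g.eta_pos by (intro mult_mono) auto
    moreover have "(f.Finv t - g.Finv (t - \<beta>))\<^sup>2 - (f.Finv t - g.Finv (t - \<alpha>))\<^sup>2
        = (g.Finv (t - \<alpha>) - g.Finv (t - \<beta>)) * (2 * f.Finv t - g.Finv (t - \<beta>) - g.Finv (t - \<alpha>))"
      by algebra
    ultimately show ?thesis by (simp only: abs_mult ac_simps)
  qed
  have der: "((\<lambda>\<beta>. (f.Finv t - g.Finv (t - \<beta>))\<^sup>2) has_real_derivative d t) (at \<alpha>)"
    if "t \<notin> (+) \<alpha> ` M" for t
  proof -
    have "t - \<alpha> \<notin> M" using that by (metis add.commute diff_add_cancel imageI)
    then have "((\<lambda>\<beta>. g.Finv (t - \<beta>)) has_real_derivative 1 / g (g.Finv (t - \<alpha>)) * (- 1)) (at \<alpha>)"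
      by (intro DERIV_chain2[OF M(2)]) (auto intro!: derivative_eq_intros)
    from DERIV_power[OF DERIV_diff[OF DERIV_const[of "f.Finv t"] this], of 2]
    show ?thesis by (simp add: d_def \<psi>_def ac_simps)
  qed
  have "negligible ((+) \<alpha> ` M)" using M(1) by (rule negligible_translation)
  note * = integral_lipschitz_has_derivative[where N = "(+) \<alpha> ` M"
      and \<Phi> = "\<lambda>\<beta> t. (f.Finv t - g.Finv (t - \<beta>))\<^sup>2", OF int lip this der]
  have "integral {0..1} d = integral {0..1} (\<lambda>t. d (t + \<alpha>))"
  proof (rule periodic_integral_shift[symmetric])
    show "d (t + 1) = d t" for t
      using f.Finv_add_one[of t] g.Finv_add_one[of "t - \<alpha>"] g.density_Finv_add_one[of "t - \<alpha>"]
      by (simp add: d_def \<psi>_def algebra_simps)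
    show "d integrable_on {0..1}" using *(1) by (simp add: absolutely_integrable_on_def)
  qed
  also have "\<dots> = integral {0..1} (\<lambda>y. \<psi> y / g (g.Finv y))" by (simp add: d_def)
  also have "\<dots> = integral {0..1} (\<lambda>t. \<psi> (g.F t))"
    by (rule g.integral_density_substitution) (auto simp: \<psi>_def[abs_def] intro!: continuous_intros)
  also have "\<dots> = 2 * integral {0..1} (\<lambda>t. f.Finv (g.F t + \<alpha>) - t)"
    by (simp only: \<psi>_def g.Finv_cdf integral_mult_right)
  also have "\<dots> = 2 * (transport_mean \<alpha> - integral {0..1} (\<lambda>t. t))"
    unfolding transport_mean_def
    by (subst integral_diff)
      (auto intro!: integrable_continuous_real continuous_intros)
  also have "\<dots> = 2 * transport_mean \<alpha> - 1" using integral_unique[OF ident_has_integral[of 0 1]] by simp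
  finally show ?thesis using *(2) by (simp add: circle_cost_eq[abs_def])
qed

text \<open>Integrability is asserted as well, because \<open>integral\<close> has the default value
  0 on non-integrable functions and the formula alone would not exclude that case.\<close>

lemma deriv_circle_cost_has_derivative:
  "(\<lambda>t. 2 / f (f.Finv (g.F t + \<alpha>))) absolutely_integrable_on {0..1}"
  "(deriv (circle_cost f g) has_real_derivative integral {0..1} (\<lambda>t. 2 / f (f.Finv (g.F t + \<alpha>)))) (at \<alpha>)"
proof -
  have 2: "(\<lambda>t. 2 / f (f.Finv (g.F t + \<alpha>))) = (\<lambda>t. 2 *\<^sub>R (1 / f (f.Finv (g.F t + \<alpha>))))"
    by simp
  show "(\<lambda>t. 2 / f (f.Finv (g.F t + \<alpha>))) absolutely_integrable_on {0..1}"
    unfolding 2 by (intro absolutely_integrable_scaleR_left transport_mean_has_derivative)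
  have "deriv (circle_cost f g) = (\<lambda>\<alpha>. 2 * transport_mean \<alpha> - 1)"
    using circle_cost_has_derivative by (auto intro: DERIV_imp_deriv)
  moreover have "((\<lambda>\<alpha>. 2 * transport_mean \<alpha> - 1) has_real_derivative
      2 * integral {0..1} (\<lambda>t. 1 / f (f.Finv (g.F t + \<alpha>)))) (at \<alpha>)"
    by (auto intro!: derivative_eq_intros transport_mean_has_derivative)
  moreover have "integral {0..1} (\<lambda>t. 2 / f (f.Finv (g.F t + \<alpha>)))
      = 2 * integral {0..1} (\<lambda>t. 1 / f (f.Finv (g.F t + \<alpha>)))"
    unfolding 2 real_scaleR_def by (rule integral_mult_right)
  ultimately show "(deriv (circle_cost f g) has_real_derivative
      integral {0..1} (\<lambda>t. 2 / f (f.Finv (g.F t + \<alpha>)))) (at \<alpha>)"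
    by simp
qed

text \<open>By the swap symmetry the chain rule for \<open>- \<alpha>\<close> is applied twice, once
  per derivative, and the two signs cancel.\<close>

lemma deriv_circle_cost_has_derivative_swap:
  "(\<lambda>t. 2 / g (g.Finv (f.F t - \<alpha>))) absolutely_integrable_on {0..1}"
  "(deriv (circle_cost f g) has_real_derivative integral {0..1} (\<lambda>t. 2 / g (g.Finv (f.F t - \<alpha>)))) (at \<alpha>)"
proof -
  interpret swap: circle_density_pair g f \<theta> \<eta> ..
  show "(\<lambda>t. 2 / g (g.Finv (f.F t - \<alpha>))) absolutely_integrable_on {0..1}"
    using swap.deriv_circle_cost_has_derivative(1)[of "- \<alpha>"] by simp
  have neg: "((\<lambda>\<alpha>. - \<alpha>) has_real_derivative - 1) (at \<alpha>)" for \<alpha> :: real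
    by (auto intro!: derivative_eq_intros)
  have "(circle_cost f g has_real_derivative deriv (circle_cost g f) (- \<alpha>) * (- 1)) (at \<alpha>)" for \<alpha>
    using DERIV_chain2[OF _ neg] swap.circle_cost_has_derivative[of "- \<alpha>"]
    unfolding circle_cost_swap[abs_def] by (metis DERIV_imp_deriv)
  then have "deriv (circle_cost f g) = (\<lambda>\<alpha>. - deriv (circle_cost g f) (- \<alpha>))"
    by (auto intro!: DERIV_imp_deriv)
  then show "(deriv (circle_cost f g) has_real_derivative integral {0..1} (\<lambda>t. 2 / g (g.Finv (f.F t - \<alpha>)))) (at \<alpha>)"
    using DERIV_minus[OF DERIV_chain2[OF swap.deriv_circle_cost_has_derivative(2) neg], of \<alpha>]
    by simp
qed

end

text \<open>Both derivatives have the opposite sign to the formulas displayed in English: for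
  \<open>f = g = 1\<close> the cost is \<open>\<alpha>\<^sup>2\<close> with derivative
  \<open>2 * \<alpha>\<close>, and a convex function cannot have a negative second derivative. The
  minimizers in the last clause range over the whole line.\<close>

theorem lemma3p1:
  fixes f g F G Finv Ginv I :: "real \<Rightarrow> real"
  assumes "f \<in> circle_densities" and "g \<in> circle_densities"
  defines "F \<equiv> circle_cdf f" and "G \<equiv> circle_cdf g"
  defines "Finv \<equiv> inverse_dist F" and "Ginv \<equiv> inverse_dist G"
  defines "I \<equiv> circle_cost f g"
  shows "strictly_convex_on UNIV I \<and>
    (\<forall>\<alpha>. (I has_real_derivative 2 * integral {0..1} (\<lambda>t. Finv (G t + \<alpha>)) - 1) (at \<alpha>)) \<and>
    (\<forall>\<alpha>. (\<lambda>t. 2 / f (Finv (G t + \<alpha>))) absolutely_integrable_on {0..1} \<and>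
         (\<lambda>t. 2 / g (Ginv (F t - \<alpha>))) absolutely_integrable_on {0..1} \<and>
         (deriv I has_real_derivative integral {0..1} (\<lambda>t. 2 / f (Finv (G t + \<alpha>)))) (at \<alpha>) \<and>
         (deriv I has_real_derivative integral {0..1} (\<lambda>t. 2 / g (Ginv (F t - \<alpha>)))) (at \<alpha>)) \<and>
    (\<exists>\<alpha>\<in>{-1<..<1}. {\<beta>. \<forall>\<gamma>. I \<beta> \<le> I \<gamma>} = {\<alpha>})"
proof -
  obtain \<eta> where \<eta>: "0 < \<eta>" "negligible {t. f t < \<eta>}" using circle_densityE[OF assms(1)] .
  obtain \<theta> where \<theta>: "0 < \<theta>" "negligible {t. g t < \<theta>}" using circle_densityE[OF assms(2)] .
  interpret circle_density_pair f g \<eta> \<theta>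
    using assms(1,2) \<eta> \<theta> by unfold_locales
  \<comment> \<open>This is the derivative of \<open>I\<close>. Its monotonicity yields convexity,
    and together with its signs at -1 and 1 the location and uniqueness of the minimum.\<close>
  have mono: "strict_mono (\<lambda>\<alpha>. 2 * transport_mean \<alpha> - 1)"
    using transport_mean_strict_mono by (simp add: strict_mono_def)
  have cont: "continuous_on {-1..1} (\<lambda>\<alpha>. 2 * transport_mean \<alpha> - 1)"
    by (intro continuous_on_diff continuous_on_mult_left continuous_on_const
        DERIV_continuous_on[OF has_field_derivative_at_within[OF transport_mean_has_derivative(2)]])
  have "\<exists>\<alpha>\<in>{-1<..<1}. {\<beta>. \<forall>\<gamma>. I \<beta> \<le> I \<gamma>} = {\<alpha>}"
    unfolding I_def using transport_mean_bounds
    by (intro unique_minimum_derivative[OF circle_cost_has_derivative mono cont]) auto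
  moreover have "strictly_convex_on UNIV I"
    unfolding I_def by (rule strictly_convex_on_UNIV_derivative[OF circle_cost_has_derivative mono])
  ultimately show ?thesis
    using circle_cost_has_derivative deriv_circle_cost_has_derivative
      deriv_circle_cost_has_derivative_swap
    unfolding F_def G_def Finv_def Ginv_def I_def transport_mean_def by simp
qed

end
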